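(* Let $q\in(0,\infty)$ and $r\in(0,4]$, and let $\Phi_{q,r}=\phi_q\circ f_r:[0,1]\to[0,1]$ be the $q$-deformed logistic map, where $f_r(x)=rx(1-x)$, $\phi_q(x)=\frac{1-q^x}{1-q}$ for $q\ne1$, and $\phi_1(x)=x$. Then the following statements hold. 1. If the fixed point $0$ of $\Phi_{q,r}$ is LAS, then it is GAS if and only if $\Phi_{q,r}(x)<x$ for all $x\in(0,1)$. 2. If $\Phi_{q,r}$ has a non-zero LAS fixed point, then this fixed point is GAS if and only if the fixed point $0$ is not LAS.
   Context: Let $I=[0,1]$, let $f:I\to I$ be continuous and let $f^n$ denote the $n$-th iterate of $f$. Neighborhoods are taken relative to $I$. A fixed point $x_0$ of $f$ is: - locally stable if for each $\varepsilon>0$ there is a neighborhood $V$ of $x_0$ such that $|f^n(x)-x_0|<\varepsilon$ for every $x\in V$ and every $n\in\mathbb{N}$; - attracting if there is a neighborhood $V$ of $x_0$ such that $\lim_{n\to\infty}f^n(x)=x_0$ for every $x\in V$; - locally asymptotically stable (LAS) if it is both locally stable and attracting; - globally asymptotically stable (GAS) if it is LAS and $\lim_{n\to\infty}f^n(x)=x_0$ for every $x\in\mathrm{int}(I)=(0,1)$. *)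

theory Defs
  imports "HOL-Analysis.Analysis"
begin

text \<open>
  A self-map of the unit interval is represented by a function on the reals, of which only the
  values on \<open>{0..1}\<close> matter below.
\<close>

definition unit_nbhd :: "real \<Rightarrow> real set \<Rightarrow> bool" where
  "unit_nbhd x0 V \<longleftrightarrow>
     V \<subseteq> {0..1} \<and> (\<exists>U. openin (top_of_set {0..1}) U \<and> x0 \<in> U \<and> U \<subseteq> V)"

definition fixed_point :: "(real \<Rightarrow> real) \<Rightarrow> real \<Rightarrow> bool" where
  "fixed_point f x0 \<longleftrightarrow> x0 \<in> {0..1} \<and> f x0 = x0"

definition locally_stable :: "(real \<Rightarrow> real) \<Rightarrow> real \<Rightarrow> bool" where
  "locally_stable f x0 \<longleftrightarrow>
     (\<forall>\<epsilon>>0. \<exists>V. unit_nbhd x0 V \<and> (\<forall>x\<in>V. \<forall>n. \<bar>(f ^^ n) x - x0\<bar> < \<epsilon>))"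

definition attracting :: "(real \<Rightarrow> real) \<Rightarrow> real \<Rightarrow> bool" where
  "attracting f x0 \<longleftrightarrow>
     (\<exists>V. unit_nbhd x0 V \<and> (\<forall>x\<in>V. (\<lambda>n. (f ^^ n) x) \<longlonglongrightarrow> x0))"

definition LAS :: "(real \<Rightarrow> real) \<Rightarrow> real \<Rightarrow> bool" where
  "LAS f x0 \<longleftrightarrow> fixed_point f x0 \<and> locally_stable f x0 \<and> attracting f x0"

definition GAS :: "(real \<Rightarrow> real) \<Rightarrow> real \<Rightarrow> bool" where
  "GAS f x0 \<longleftrightarrow> LAS f x0 \<and> (\<forall>x\<in>{0<..<1}. (\<lambda>n. (f ^^ n) x) \<longlonglongrightarrow> x0)"

definition logistic :: "real \<Rightarrow> real \<Rightarrow> real" where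
  "logistic r x = r * x * (1 - x)"

definition qdeform :: "real \<Rightarrow> real \<Rightarrow> real" where
  "qdeform q x = (if q = 1 then x else (1 - q powr x) / (1 - q))"

definition qlogistic :: "real \<Rightarrow> real \<Rightarrow> real \<Rightarrow> real" where
  "qlogistic q r = qdeform q \<circ> logistic r"

lemma logistic_in_unit:
  assumes "0 < r" "r \<le> 4" "x \<in> {0..1}"
  shows "logistic r x \<in> {0..1}"
proof -
  have xx: "0 \<le> x * (1 - x)" using assms(3) by simp
  have "4 * (x * (1 - x)) \<le> 1"
    using zero_le_power2[of "2 * x - 1"] by (simp add: power2_eq_square algebra_simps)
  moreover have "r * (x * (1 - x)) \<le> 4 * (x * (1 - x))"
    using assms(2) xx by (rule mult_right_mono)
  moreover have "0 \<le> r * (x * (1 - x))" using assms(1) xx by simp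
  ultimately show ?thesis by (simp add: logistic_def mult.assoc)
qed

lemma qdeform_in_unit:
  assumes "0 < q" "x \<in> {0..1}"
  shows "qdeform q x \<in> {0..1}"
proof (cases q "1 :: real" rule: linorder_cases)
  case less
  have "q powr 1 \<le> q powr x" "q powr x \<le> q powr 0"
    using assms less by (intro powr_mono'; simp)+
  then show ?thesis using assms less by (simp add: qdeform_def divide_simps)
next
  case equal
  then show ?thesis using assms by (simp add: qdeform_def)
next
  case greater
  have "q powr x \<le> q powr 1" "q powr 0 \<le> q powr x"
    using assms greater by (intro powr_mono; simp)+
  then show ?thesis using assms greater by (simp add: qdeform_def divide_simps)
qed

lemma qlogistic_in_unit:
  assumes "0 < q" "0 < r" "r \<le> 4" "x \<in> {0..1}"
  shows "qlogistic q r x \<in> {0..1}"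
  using qdeform_in_unit[OF assms(1) logistic_in_unit[OF assms(2-4)]]
  by (simp add: qlogistic_def)

lemma fixed_point_qlogistic_0: "0 < q \<Longrightarrow> fixed_point (qlogistic q r) 0"
  by (simp add: fixed_point_def qlogistic_def qdeform_def logistic_def)

end

theory Submission
  imports Defs
begin

text \<open>
  On each of its two laps the \<open>q\<close>-deformed logistic map strictly expands the cross ratio
  \<open>((c - a) (d - b)) / ((b - a) (d - c))\<close> of four points: the logistic map does so, the
  exponential weakly so, and affine changes of variable are immaterial. Expansion excludes four
  points between which the successive slopes are \<open>\<ge> 1\<close>, \<open>\<le> 1\<close> and \<open>\<ge> 1\<close>.

  If \<open>0\<close> is not LAS, there are points arbitrarily near \<open>0\<close> on or above the diagonal; so a non-zero
  fixed point \<open>p\<close> is the only one and the graph crosses the diagonal downwards at \<open>p\<close>. For \<open>p\<close> on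
  the increasing lap orbits are then eventually monotone. For \<open>p\<close> on the decreasing lap, a point
  of \<open>[1/2, p)\<close> that the second iterate does not move up has a counterpart to the right of \<open>p\<close>
  that is not moved down; with \<open>p\<close> itself and, as \<open>p\<close> is LAS, a point close to \<open>p\<close> that is moved
  up, this gives four forbidden points for the second iterate. So the even iterates increase
  to \<open>p\<close> on \<open>[1/2, p]\<close>, and every orbit in \<open>(0,1)\<close> ends up in \<open>[1/2, \<Phi>(1/2)]\<close>, whose part right of
  \<open>p\<close> is mapped into \<open>[1/2, p]\<close>.
\<close>

section \<open>Cross ratios\<close>

text \<open>For increasing points with successive gaps L, M, R this value of the projective cross
  ratio is \<open>(1 + M/L) * (1 + M/R)\<close>.\<close>

definition cross_ratio :: "real \<Rightarrow> real \<Rightarrow> real \<Rightarrow> real \<Rightarrow> real" where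
  "cross_ratio a b c d = ((c - a) * (d - b)) / ((b - a) * (d - c))"

lemma cross_ratio_rev: "cross_ratio d c b a = cross_ratio a b c d"
proof -
  have "(b - d) * (a - c) = (c - a) * (d - b)" "(c - d) * (a - b) = (b - a) * (d - c)"
    by (simp_all add: algebra_simps)
  then show ?thesis by (simp add: cross_ratio_def)
qed

lemma cross_ratio_affine:
  assumes "k \<noteq> 0"
  shows "cross_ratio (k * a + m) (k * b + m) (k * c + m) (k * d + m) = cross_ratio a b c d"
proof -
  have *: "k * x + m - (k * y + m) = k * (x - y)" for x y by (simp add: algebra_simps)
  have "cross_ratio (k * a + m) (k * b + m) (k * c + m) (k * d + m) =
      ((k * k) * ((c - a) * (d - b))) / ((k * k) * ((b - a) * (d - c)))"
    unfolding cross_ratio_def * by (simp add: mult_ac)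
  then show ?thesis using assms by (simp add: cross_ratio_def)
qed

text \<open>Longer outer gaps and a shorter middle gap can only lower the two factors
  \<open>1 + M/L\<close> and \<open>1 + M/R\<close>; \<open>b' \<le> c'\<close> keeps the new
  factors nonnegative.\<close>

lemma cross_ratio_antimono:
  assumes "a < b" "c < d" "b' - a' \<ge> b - a" "c' - b' \<le> c - b" "d' - c' \<ge> d - c" "b' \<le> c'"
  shows "cross_ratio a' b' c' d' \<le> cross_ratio a b c d"
proof -
  have eq: "cross_ratio a b c d = (1 + (c - b) / (b - a)) * (1 + (c - b) / (d - c))"
    if "a < b" "c < d" for a b c d
    using that by (simp add: cross_ratio_def field_simps)
  have "(c' - b') / (b' - a') \<le> (c - b) / (b - a)" "(c' - b') / (d' - c') \<le> (c - b) / (d - c)"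
    using assms by (intro frac_le; linarith)+
  moreover have "(c' - b') / (b' - a') \<ge> 0" "(c' - b') / (d' - c') \<ge> 0" using assms by auto
  ultimately show ?thesis
    using assms by (subst (1 2) eq) (auto intro!: mult_mono)
qed

text \<open>Squaring multiplies the cross ratio by
  \<open>((c + a) * (d + b)) / ((b + a) * (d + c))\<close>. This exceeds 1: numerator minus
  denominator is \<open>(d - a) * (c - b)\<close>, and the denominator is positive for points on one
  side of 0.\<close>

lemma cross_ratio_square_less:
  assumes "a < b" "b < c" "c < d" "0 \<le> a \<or> d \<le> 0"
  shows "cross_ratio a b c d < cross_ratio (a\<^sup>2) (b\<^sup>2) (c\<^sup>2) (d\<^sup>2)"
proof -
  have sq: "x\<^sup>2 - y\<^sup>2 = (x - y) * (x + y)" for x y :: real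
    by (simp add: power2_eq_square algebra_simps)
  have pos: "0 < (a + b) * (c + d)" using assms by (auto simp: zero_less_mult_iff)
  have "(c + a) * (d + b) - (b + a) * (d + c) = (d - a) * (c - b)" by (simp add: algebra_simps)
  moreover have "0 < (d - a) * (c - b)" using assms by simp
  ultimately have "1 < ((c + a) * (d + b)) / ((b + a) * (d + c))"
    using pos by (simp add: add.commute)
  moreover have "0 < cross_ratio a b c d" using assms by (simp add: cross_ratio_def)
  ultimately have "cross_ratio a b c d * 1 <
      cross_ratio a b c d * (((c + a) * (d + b)) / ((b + a) * (d + c)))"
    by (intro mult_strict_left_mono)
  also have "\<dots> = cross_ratio (a\<^sup>2) (b\<^sup>2) (c\<^sup>2) (d\<^sup>2)"
    by (simp add: cross_ratio_def sq mult_ac)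
  finally show ?thesis by simp
qed

text \<open>The derivative has the numerator \<open>s * cosh s - sinh s\<close>, which vanishes at 0
  and itself has the derivative \<open>s * sinh s\<close>, nonnegative for
  \<open>s \<ge> 0\<close>.\<close>

lemma sinh_div_mono:
  fixes x y :: real
  assumes "0 < x" "x \<le> y"
  shows "sinh x / x \<le> sinh y / y"
proof -
  have nonneg: "0 \<le> t * cosh t - sinh t" if "0 \<le> t" for t :: real
  proof -
    have "0 * cosh 0 - sinh (0::real) \<le> t * cosh t - sinh t"
    proof (rule DERIV_nonneg_imp_nondecreasing[OF that])
      fix s :: real assume "0 \<le> s"
      have "((\<lambda>t. t * cosh t - sinh t) has_real_derivative s * sinh s) (at s)"
        by (auto intro!: derivative_eq_intros)
      then show "\<exists>y. ((\<lambda>t. t * cosh t - sinh t) has_real_derivative y) (at s) \<and> 0 \<le> y"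
        using \<open>0 \<le> s\<close> by auto
    qed
    then show ?thesis by simp
  qed
  show ?thesis
  proof (rule DERIV_nonneg_imp_nondecreasing[OF assms(2)])
    fix s assume "x \<le> s"
    then have "0 < s" using assms by simp
    then have "((\<lambda>t. sinh t / t) has_real_derivative (s * cosh s - sinh s) / s\<^sup>2) (at s)"
      by (auto intro!: derivative_eq_intros simp: power2_eq_square mult_ac)
    then show "\<exists>y. ((\<lambda>t. sinh t / t) has_real_derivative y) (at s) \<and> 0 \<le> y"
      using nonneg[of s] \<open>0 < s\<close> by (auto intro!: exI)
  qed
qed

text \<open>
  Writing \<open>exp y - exp x = 2 exp ((x + y) / 2) sinh ((y - x) / 2)\<close>, the exponential factors cancel
  in the cross ratio, and what remains is the monotonicity of \<open>sinh x / x\<close>.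
\<close>
lemma cross_ratio_exp_le:
  assumes "a < b" "b < c" "c < d"
  shows "cross_ratio a b c d \<le> cross_ratio (exp a) (exp b) (exp c) (exp d)"
proof -
  define S where "S t = sinh t / t" for t :: real
  have S: "exp y - exp x = (y - x) * exp (x / 2) * exp (y / 2) * S ((y - x) / 2)" if "x < y"
    for x y :: real
  proof -
    have "exp (x / 2) * exp (y / 2) * exp ((y - x) / 2) = exp y"
      "exp (x / 2) * exp (y / 2) * exp (- ((y - x) / 2)) = exp x"
      unfolding exp_add[symmetric] by (simp_all add: field_simps)
    then have "exp (x / 2) * exp (y / 2) * (2 * sinh ((y - x) / 2)) = exp y - exp x"
      by (simp add: sinh_field_def right_diff_distrib)
    moreover have "(y - x) * S ((y - x) / 2) = 2 * sinh ((y - x) / 2)"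
      using that by (simp add: S_def)
    ultimately show ?thesis by (metis mult.assoc mult.commute)
  qed
  have S_pos: "0 < S t" if "0 < t" for t using that by (simp add: S_def)
  define P where "P = S ((b - a) / 2) * S ((d - c) / 2)"
  define Q where "Q = S ((c - a) / 2) * S ((d - b) / 2)"
  \<comment> \<open>Each of the four points occurs once in either product of two differences, so
    \<open>K\<close> is common to numerator and denominator.\<close>
  define K where "K = exp (a / 2) * exp (b / 2) * exp (c / 2) * exp (d / 2)"
  \<comment> \<open>The intervals in the numerator contain those in the denominator.\<close>
  have "S ((b - a) / 2) \<le> S ((c - a) / 2)" "S ((d - c) / 2) \<le> S ((d - b) / 2)"
    unfolding S_def using assms by (intro sinh_div_mono; simp)+
  then have "P \<le> Q" unfolding P_def Q_def using assms S_pos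
    by (intro mult_mono) (auto intro: less_imp_le)
  moreover have "0 < P" unfolding P_def using assms S_pos by simp
  ultimately have "1 \<le> Q / P" by simp
  moreover have "0 < cross_ratio a b c d" using assms by (simp add: cross_ratio_def)
  ultimately have "cross_ratio a b c d * 1 \<le> cross_ratio a b c d * (Q / P)"
    by (intro mult_left_mono) auto
  also have "\<dots> = (K * ((c - a) * (d - b) * Q)) / (K * ((b - a) * (d - c) * P))"
    by (simp add: cross_ratio_def K_def)
  also have "K * ((c - a) * (d - b) * Q) = (exp c - exp a) * (exp d - exp b)"
    using assms by (simp add: S K_def Q_def mult_ac)
  also have "K * ((b - a) * (d - c) * P) = (exp b - exp a) * (exp d - exp c)"
    using assms by (simp add: S K_def P_def mult_ac)
  finally show ?thesis by (simp add: cross_ratio_def)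
qed

section \<open>Neighborhoods and monotone orbits\<close>

lemma unit_nbhdD:
  assumes "unit_nbhd x0 V"
  obtains \<delta> where "0 < \<delta>" "\<And>x. x \<in> {0..1} \<Longrightarrow> \<bar>x - x0\<bar> < \<delta> \<Longrightarrow> x \<in> V"
proof -
  obtain U where "openin (top_of_set {0..1}) U" "x0 \<in> U" "U \<subseteq> V"
    using assms by (auto simp: unit_nbhd_def)
  then obtain \<delta> where "0 < \<delta>" "\<forall>x\<in>{0..1}. dist x x0 < \<delta> \<longrightarrow> x \<in> U"
    unfolding openin_euclidean_subtopology_iff by meson
  with \<open>U \<subseteq> V\<close> show ?thesis by (intro that) (auto simp: dist_real_def)
qed

lemma unit_nbhd_ball:
  assumes "x0 \<in> {0..1}" "0 < \<delta>"
  shows "unit_nbhd x0 ({0..1} \<inter> ball x0 \<delta>)"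
  unfolding unit_nbhd_def using assms by (auto intro!: exI[of _ "{0..1} \<inter> ball x0 \<delta>"])

text \<open>Continuity makes the limit of a bounded monotone orbit a fixed point, so knowing the
  fixed points in \<open>{a..b}\<close> determines the limit.\<close>

lemma monoseq_orbit_convergent:
  fixes f :: "real \<Rightarrow> real"
  assumes "continuous_on {a..b} f" "\<And>n. (f ^^ n) x \<in> {a..b}" "monoseq (\<lambda>n. (f ^^ n) x)"
  obtains l where "l \<in> {a..b}" "f l = l" "(\<lambda>n. (f ^^ n) x) \<longlonglongrightarrow> l"
proof -
  have "Bseq (\<lambda>n. (f ^^ n) x)"
    using assms(2) by (intro BseqI'[of _ "\<bar>a\<bar> + \<bar>b\<bar>"]) (auto simp: abs_le_iff; smt (verit))
  then obtain l where l: "(\<lambda>n. (f ^^ n) x) \<longlonglongrightarrow> l"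
    using assms(3) Bseq_monoseq_convergent by (auto simp: convergent_def)
  have lab: "l \<in> {a..b}"
    using closed_sequentially[OF closed_atLeastAtMost _ l] assms(2) by blast
  have "(\<lambda>n. f ((f ^^ n) x)) \<longlonglongrightarrow> f l"
    by (rule continuous_on_tendsto_compose[OF assms(1) l lab]) (use assms(2) in auto)
  moreover have "(\<lambda>n. f ((f ^^ n) x)) \<longlonglongrightarrow> l"
    using LIMSEQ_Suc[OF l] by simp
  ultimately have "f l = l" by (rule LIMSEQ_unique)
  with lab l show ?thesis by (intro that)
qed

lemma orbit_in_invariant:
  assumes "x \<in> A" "\<And>t. t \<in> A \<Longrightarrow> f t \<in> A"
  shows "(f ^^ n) x \<in> A"
  using assms by (induction n) auto

lemma orbit_tendsto_shift:
  fixes f :: "real \<Rightarrow> real"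
  assumes "(\<lambda>n. (f ^^ n) ((f ^^ k) x)) \<longlonglongrightarrow> l"
  shows "(\<lambda>n. (f ^^ n) x) \<longlonglongrightarrow> l"
  by (rule LIMSEQ_offset[of _ k]) (use assms in \<open>simp add: funpow_add\<close>)

text \<open>The even iterates form the orbit of \<open>x\<close> under \<open>f \<circ> f\<close>,
  the odd ones that of \<open>f x\<close>.\<close>

lemma orbit_tendsto_of_square:
  fixes f :: "real \<Rightarrow> real"
  assumes "(\<lambda>n. ((f \<circ> f) ^^ n) x) \<longlonglongrightarrow> l" "(\<lambda>n. ((f \<circ> f) ^^ n) (f x)) \<longlonglongrightarrow> l"
  shows "(\<lambda>n. (f ^^ n) x) \<longlonglongrightarrow> l"
proof -
  have ff: "f \<circ> f = f ^^ 2" by (simp add: numeral_2_eq_2)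
  have "(f ^^ (2 * n)) x = ((f \<circ> f) ^^ n) x" "(f ^^ Suc (2 * n)) x = ((f \<circ> f) ^^ n) (f x)" for n
    unfolding ff funpow_mult funpow_Suc_right by simp_all
  with assms have lim: "(\<lambda>n. (f ^^ (2 * n)) x) \<longlonglongrightarrow> l" "(\<lambda>n. (f ^^ Suc (2 * n)) x) \<longlonglongrightarrow> l"
    by presburger+
  show ?thesis
  proof (rule LIMSEQ_I)
    fix e :: real assume "0 < e"
    then obtain M N where M: "\<And>n. n \<ge> M \<Longrightarrow> norm ((f ^^ (2 * n)) x - l) < e"
      and N: "\<And>n. n \<ge> N \<Longrightarrow> norm ((f ^^ Suc (2 * n)) x - l) < e"
      using lim[THEN LIMSEQ_D] by meson
    have "norm ((f ^^ n) x - l) < e" if "n \<ge> 2 * M + 2 * N + 1" for n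
    proof (cases "even n")
      case True
      then show ?thesis using M[of "n div 2"] that by simp
    next
      case False
      then show ?thesis using N[of "n div 2"] that by simp
    qed
    then show "\<exists>no. \<forall>n\<ge>no. norm ((f ^^ n) x - l) < e" by blast
  qed
qed

section \<open>Unimodal maps that expand cross ratios\<close>

text \<open>
  Expansion of cross ratios on both laps replaces the usual assumption of a negative Schwarzian
  derivative.
\<close>
locale cross_ratio_unimodal =
  fixes f :: "real \<Rightarrow> real" and c :: real
  assumes c_pos: "0 < c" and c_less_1: "c < 1"
    and cont: "continuous_on {0..1} f"
    and f_0: "f 0 = 0" and f_1: "f 1 = 0" and f_c_le_1: "f c \<le> 1"
    and incr: "\<lbrakk>0 \<le> x; x < y; y \<le> c\<rbrakk> \<Longrightarrow> f x < f y"
    and decr: "\<lbrakk>c \<le> x; x < y; y \<le> 1\<rbrakk> \<Longrightarrow> f y < f x"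
    and expand_left: "\<lbrakk>0 \<le> w; w < x; x < y; y < z; z \<le> c\<rbrakk> \<Longrightarrow>
      cross_ratio w x y z < cross_ratio (f w) (f x) (f y) (f z)"
    and expand_right: "\<lbrakk>c \<le> w; w < x; x < y; y < z; z \<le> 1\<rbrakk> \<Longrightarrow>
      cross_ratio w x y z < cross_ratio (f w) (f x) (f y) (f z)"
begin

lemma incr_le: "\<lbrakk>0 \<le> x; x \<le> y; y \<le> c\<rbrakk> \<Longrightarrow> f x \<le> f y"
  using incr[of x y] by (cases "x = y") auto

lemma decr_le: "\<lbrakk>c \<le> x; x \<le> y; y \<le> 1\<rbrakk> \<Longrightarrow> f y \<le> f x"
  using decr[of x y] by (cases "x = y") auto

lemma f_nonneg: "x \<in> {0..1} \<Longrightarrow> 0 \<le> f x"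
  using incr_le[of 0 x] decr_le[of x 1] f_0 f_1 by (cases "x \<le> c") auto

lemma f_pos: "\<lbrakk>0 < x; x < 1\<rbrakk> \<Longrightarrow> 0 < f x"
  using incr[of 0 x] decr[of x 1] f_0 f_1 by (cases "x \<le> c") auto

lemma f_le_f_c: "x \<in> {0..1} \<Longrightarrow> f x \<le> f c"
  using incr_le[of x c] decr_le[of c x] by (cases "x \<le> c") auto

lemma f_in_unit: "x \<in> {0..1} \<Longrightarrow> f x \<in> {0..1}"
  using f_nonneg f_le_f_c f_c_le_1 by fastforce

section \<open>Stability of the fixed point 0\<close>

text \<open>The orbit decreases to a fixed point in \<open>{0..x}\<close>, which can only be 0.
  Small \<open>\<eta>\<close> serves local stability, \<open>\<eta> = 1\<close> global
  convergence.\<close>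

lemma orbit_below_diagonal:
  assumes "0 \<le> x" "x < \<eta>" "\<eta> \<le> 1" and below: "\<And>t. 0 < t \<Longrightarrow> t < \<eta> \<Longrightarrow> f t < t"
  shows "(f ^^ n) x \<in> {0..x}" "(\<lambda>n. (f ^^ n) x) \<longlonglongrightarrow> 0"
proof -
  have inv: "0 \<le> f t \<and> f t \<le> t" if "t \<in> {0..x}" for t
  proof (cases "t = 0")
    case False
    then show ?thesis using that assms(2,3) f_nonneg[of t] less_imp_le[OF below[of t]] by simp
  qed (use f_0 in simp)
  have orb: "(f ^^ n) x \<in> {0..x}" for n
    by (rule orbit_in_invariant) (use assms(1) inv in force)+
  then show "(f ^^ n) x \<in> {0..x}" .
  have "monoseq (\<lambda>n. (f ^^ n) x)"
    unfolding monoseq_Suc using inv[OF orb] by simp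
  moreover have "continuous_on {0..x} f"
    using assms by (intro continuous_on_subset[OF cont]) auto
  ultimately obtain l where "l \<in> {0..x}" "f l = l" "(\<lambda>n. (f ^^ n) x) \<longlonglongrightarrow> l"
    using monoseq_orbit_convergent orb by blast
  moreover have "l = 0"
    using \<open>l \<in> {0..x}\<close> \<open>f l = l\<close> assms(2) below[of l] by force
  ultimately show "(\<lambda>n. (f ^^ n) x) \<longlonglongrightarrow> 0" by simp
qed

text \<open>Needed in contrapositive form: if 0 is not LAS, points \<open>s > 0\<close> with
  \<open>s \<le> f s\<close> lie arbitrarily near 0.\<close>

lemma LAS_0_of_below_diagonal:
  assumes "0 < \<eta>" "\<eta> \<le> 1" and below: "\<And>t. 0 < t \<Longrightarrow> t < \<eta> \<Longrightarrow> f t < t"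
  shows "LAS f 0"
  unfolding LAS_def
proof (intro conjI)
  show "fixed_point f 0" by (simp add: fixed_point_def f_0)
  show "attracting f 0"
    unfolding attracting_def
    using assms unit_nbhd_ball[of 0 \<eta>] orbit_below_diagonal(2)[OF _ _ assms(2) below]
    by (intro exI[of _ "{0..1} \<inter> ball 0 \<eta>"]) (auto simp: dist_real_def)
  show "locally_stable f 0"
    unfolding locally_stable_def
  proof (intro allI impI)
    fix \<epsilon> :: real assume "0 < \<epsilon>"
    have "\<bar>(f ^^ n) x - 0\<bar> < \<epsilon>" if "x \<in> {0..1} \<inter> ball 0 (min \<epsilon> \<eta>)" for x n
      using that orbit_below_diagonal(1)[OF _ _ assms(2) below, of x n] by (auto simp: dist_real_def)
    then show "\<exists>V. unit_nbhd 0 V \<and> (\<forall>x\<in>V. \<forall>n. \<bar>(f ^^ n) x - 0\<bar> < \<epsilon>)"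
      using unit_nbhd_ball[of 0 "min \<epsilon> \<eta>"] \<open>0 < \<epsilon>\<close> assms(1) by
      (metis atLeastAtMost_iff le_numeral_extra(1,3) min_less_iff_conj)
  qed
qed

text \<open>A point of (0,1) on or above the diagonal yields, as \<open>f 1 = 0\<close>, a fixed
  point in (0,1), whose constant orbit does not tend to 0.\<close>

lemma GAS_0_iff:
  assumes "LAS f 0"
  shows "GAS f 0 \<longleftrightarrow> (\<forall>x\<in>{0<..<1}. f x < x)"
proof
  assume "\<forall>x\<in>{0<..<1}. f x < x"
  then show "GAS f 0"
    using assms orbit_below_diagonal(2)[of _ 1] by (auto simp: GAS_def)
next
  assume gas: "GAS f 0"
  show "\<forall>x\<in>{0<..<1}. f x < x"
  proof (intro ballI, rule ccontr)
    fix x assume x: "x \<in> {0<..<1}" "\<not> f x < x"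
    have "continuous_on {x..1} (\<lambda>t. f t - t)"
      using x by (intro continuous_intros continuous_on_subset[OF cont]) auto
    then obtain t where t: "x \<le> t" "t \<le> 1" "f t - t = 0"
      using IVT2'[of "\<lambda>t. f t - t" 1 0 x] x f_1 by auto
    then have "t \<in> {0<..<1}" using x f_1 by (cases "t = 1") auto
    with gas have "(\<lambda>n. (f ^^ n) t) \<longlonglongrightarrow> 0" by (auto simp: GAS_def)
    moreover have "(f ^^ n) t = t" for n using t by (induction n) auto
    ultimately have "t = 0" by (simp add: LIMSEQ_const_iff)
    then show False using \<open>t \<in> {0<..<1}\<close> by simp
  qed
qed

section \<open>Forbidden slope patterns and the position of the graph relative to the
  diagonal\<close>

text \<open>Such slopes would keep the cross ratio from growing, against its strict
  expansion.\<close>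

lemma no_three_slopes_left:
  assumes "0 \<le> w" "w < x" "x < y" "y < z" "z \<le> c"
    and "f x - f w \<ge> x - w" "f y - f x \<le> y - x" "f z - f y \<ge> z - y"
  shows False
  using assms cross_ratio_antimono[of w x y z "f x" "f w" "f y" "f z"]
    expand_left[of w x y z] incr[of x y] by simp

text \<open>By \<open>c \<le> f z\<close> and \<open>f w \<le> 1\<close> the image points lie on the
  right lap again, so both applications of \<open>f\<close> expand; each reverses the order, which
  leaves the cross ratio unchanged.\<close>

lemma no_three_slopes_square:
  assumes "c \<le> w" "w < x" "x < y" "y < z" "z \<le> 1" "c \<le> f z" "f w \<le> 1"
    and "f (f x) - f (f w) \<ge> x - w" "f (f y) - f (f x) \<le> y - x" "f (f z) - f (f y) \<ge> z - y"
  shows False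
proof -
  have less: "f z < f y" "f y < f x" "f x < f w" using assms decr by auto
  have "cross_ratio w x y z < cross_ratio (f w) (f x) (f y) (f z)"
    using assms by (intro expand_right) auto
  also have "\<dots> = cross_ratio (f z) (f y) (f x) (f w)" by (rule cross_ratio_rev[symmetric])
  also have "\<dots> < cross_ratio (f (f z)) (f (f y)) (f (f x)) (f (f w))"
    using assms less by (intro expand_right) auto
  also have "\<dots> = cross_ratio (f (f w)) (f (f x)) (f (f y)) (f (f z))" by (rule cross_ratio_rev)
  finally show False
    using assms less cross_ratio_antimono[of w x y z "f (f x)" "f (f w)" "f (f y)" "f (f z)"]
      decr[of "f y" "f x"] by simp
qed

text \<open>On the left lap a wrong sign produces a forbidden slope pattern starting at 0; on the
  right lap the monotonicity of \<open>f\<close> decides.\<close>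

lemma diagonal_signs:
  assumes "\<not> LAS f 0" "0 < p" "p < 1" "f p = p"
  shows "\<lbrakk>0 < t; t < p\<rbrakk> \<Longrightarrow> t < f t" "\<lbrakk>p < t; t \<le> 1\<rbrakk> \<Longrightarrow> f t < t"
proof -
  have small: "\<exists>s. 0 < s \<and> s < \<eta> \<and> s \<le> f s" if "0 < \<eta>" for \<eta>
    using LAS_0_of_below_diagonal[of "min \<eta> 1"] assms(1) that by force
  \<comment> \<open>The four points are 0, \<open>s\<close>, \<open>a\<close>, \<open>b\<close>,
    lying on, weakly above, weakly below and weakly above the diagonal.\<close>
  have three: False if "0 < a" "a < b" "b \<le> c" "f a \<le> a" "b \<le> f b" for a b
  proof -
    obtain s where "0 < s" "s < a" "s \<le> f s" using small \<open>0 < a\<close> by blast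
    then show False using no_three_slopes_left[of 0 s a b] that f_0 by auto
  qed
  show "t < f t" if t: "0 < t" "t < p" for t
  proof (rule ccontr)
    assume "\<not> t < f t"
    show False
    proof (cases "t < c")
      case True
      \<comment> \<open>If \<open>c \<le> p\<close>, then
        \<open>f c \<ge> f p = p \<ge> c\<close>.\<close>
      have "min p c \<le> f (min p c)"
        using assms decr_le[of c p] by (auto simp: min_def)
      then show False using three[of t "min p c"] t True \<open>\<not> t < f t\<close> by auto
    next
      case False
      then show False using decr[of t p] t assms \<open>\<not> t < f t\<close> by auto
    qed
  qed
  show "f t < t" if t: "p < t" "t \<le> 1" for t
  proof (cases "c < p")
    case True
    then show ?thesis using decr[of p t] t assms by auto
  next
    case False
    have below: "f s < s" if "p < s" "s \<le> c" for s
      using three[of p s] that assms by force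
    from this[of c] have "f c \<le> c" using False assms(4) by (cases "p = c") auto
    then show ?thesis using below[of t] decr[of c t] t by (cases "t \<le> c") auto
  qed
qed

section \<open>Fixed points on the decreasing lap\<close>

text \<open>The forbidden points are \<open>t0 < t < p < s\<close>, with
  \<open>f (f t0) \<le> t0\<close>, \<open>t < f (f t)\<close> and
  \<open>s \<le> f (f s)\<close>.\<close>

lemma above_diagonal_square:
  assumes "LAS f p" "\<not> LAS f 0" "c < p" "p < 1" "c \<le> t0" "t0 < p"
  shows "t0 < f (f t0)"
proof (rule ccontr)
  assume neg: "\<not> t0 < f (f t0)"
  have fp: "f p = p" using assms(1) by (auto simp: LAS_def fixed_point_def)
  have ft0: "p < f t0" "f t0 \<le> 1"
    using decr[of t0 p] f_in_unit[of t0] c_pos assms fp by auto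
  \<comment> \<open>Since \<open>f (f t0)\<close> may lie left of \<open>c\<close>, it is raised to
    \<open>c\<close>, so that the preimage \<open>s\<close> of \<open>u\<close> has its image on the
    right lap. As \<open>u \<le> t0\<close>,
    \<open>f (f s) = f u \<ge> f t0 \<ge> s\<close>.\<close>
  define u where "u = max c (f (f t0))"
  have u: "c \<le> u" "u \<le> t0" using neg assms by (auto simp: u_def)
  have "continuous_on {p..f t0} f"
    using assms c_pos ft0 by (intro continuous_on_subset[OF cont]) auto
  then obtain s where s: "p \<le> s" "s \<le> f t0" "f s = u"
    using IVT2'[of f "f t0" u p] u fp ft0 assms by (auto simp: u_def)
  have "p < s" using s u assms fp by (cases "s = p") auto
  have "s \<le> f (f s)" using decr_le[of u t0] s u assms by auto

  \<comment> \<open>Stability with \<open>\<epsilon> = p - c\<close> keeps orbits from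
    \<open>V\<close> to the right of \<open>c\<close>; attraction supplies \<open>W\<close>.\<close>
  obtain V W where V: "unit_nbhd p V" "\<And>x n. x \<in> V \<Longrightarrow> \<bar>(f ^^ n) x - p\<bar> < p - c"
    and W: "unit_nbhd p W" "\<And>x. x \<in> W \<Longrightarrow> (\<lambda>n. (f ^^ n) x) \<longlonglongrightarrow> p"
    using assms(1,3) unfolding LAS_def locally_stable_def attracting_def
    by (metis diff_gt_0_iff_gt)
  obtain \<delta> \<delta>' where "0 < \<delta>" "0 < \<delta>'"
    and \<delta>: "\<And>x. x \<in> {0..1} \<Longrightarrow> \<bar>x - p\<bar> < \<delta> \<Longrightarrow> x \<in> V"
    and \<delta>': "\<And>x. x \<in> {0..1} \<Longrightarrow> \<bar>x - p\<bar> < \<delta>' \<Longrightarrow> x \<in> W"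
    using unit_nbhdD[OF V(1)] unit_nbhdD[OF W(1)] by metis
  define m where "m = Max {t0, p - \<delta>, p - \<delta>'}"
  have "m < p" using assms \<open>0 < \<delta>\<close> \<open>0 < \<delta>'\<close> by (simp add: m_def)
  then obtain t where "m < t" "t < p" using dense by blast
  then have t: "t0 < t" "t < p" "t \<in> V" "t \<in> W"
    using assms c_pos by (auto simp: m_def intro!: \<delta> \<delta>')
  have "t < f (f t)"
  proof (rule ccontr)
    assume "\<not> t < f (f t)"
    \<comment> \<open>Applying \<open>f\<close> twice on the right lap preserves order, so no even
      iterate exceeds \<open>t\<close>, and the limit \<open>p\<close> could not either.\<close>
    have le: "(f ^^ (2 * n)) t \<le> t" for n
    proof (induction n)
      case (Suc n)
      let ?x = "(f ^^ (2 * n)) t"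
      have "c < ?x" using V(2)[OF t(3), of "2 * n"] by linarith
      have "f t \<le> f ?x" using Suc \<open>c < ?x\<close> t assms by (intro decr_le) auto
      moreover have "c \<le> f t" using decr_le[of t p] t assms fp by auto
      moreover have "f ?x \<le> 1" using f_in_unit[of ?x] Suc \<open>c < ?x\<close> c_pos t assms by auto
      ultimately have "f (f ?x) \<le> f (f t)" using decr_le[of "f t" "f ?x"] by simp
      then show ?case using \<open>\<not> t < f (f t)\<close> by simp
    qed simp
    have "(\<lambda>n. (f ^^ (2 * n)) t) \<longlonglongrightarrow> p"
      using LIMSEQ_subseq_LIMSEQ[OF W(2)[OF t(4)], of "\<lambda>n. 2 * n"]
      by (simp add: strict_mono_def o_def)
    then have "p \<le> t" using le by (intro LIMSEQ_le_const2) auto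
    then show False using t by simp
  qed
  then show False
    using no_three_slopes_square[of t0 t p s] neg t fp s u \<open>p < s\<close> \<open>s \<le> f (f s)\<close> ft0 assms by auto
qed

text \<open>An orbit staying below \<open>c\<close> would increase to a fixed point in
  \<open>{x..c}\<close>, but there is none.\<close>

lemma orbit_reaches_right_lap:
  assumes "\<And>t. 0 < t \<Longrightarrow> t \<le> c \<Longrightarrow> t < f t" "0 < x" "x \<le> 1"
  obtains n where "c \<le> (f ^^ n) x" "(f ^^ n) x \<le> 1"
proof -
  have orb: "(f ^^ n) x \<in> {0..1}" for n
    using assms f_in_unit by (intro orbit_in_invariant) auto
  have "\<exists>n. c \<le> (f ^^ n) x"
  proof (rule ccontr)
    assume "\<nexists>n. c \<le> (f ^^ n) x"
    then have below: "(f ^^ n) x < c" for n by (meson not_le)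
    have ge: "x \<le> (f ^^ n) x" for n
    proof (induction n)
      case (Suc n)
      then show ?case using assms(1)[of "(f ^^ n) x"] assms(2) below[of n] by simp
    qed simp
    have "monoseq (\<lambda>n. (f ^^ n) x)"
    proof -
      have "(f ^^ n) x \<le> (f ^^ Suc n) x" for n
        using assms(1)[of "(f ^^ n) x"] assms(2) below[of n] ge[of n] by simp
      then show ?thesis unfolding monoseq_Suc by blast
    qed
    moreover have "continuous_on {x..c} f"
      using assms c_less_1 by (intro continuous_on_subset[OF cont]) auto
    moreover have "(f ^^ n) x \<in> {x..c}" for n using below[of n] ge[of n] by simp
    ultimately obtain l where "l \<in> {x..c}" "f l = l"
      using monoseq_orbit_convergent by blast
    then show False using assms(1)[of l] assms(2) by simp
  qed
  then show ?thesis using that orb by auto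
qed

lemma tendsto_fixed_point_right_lap:
  assumes "LAS f p" "\<not> LAS f 0" "c < p" "p < 1" "0 < x" "x < 1"
  shows "(\<lambda>n. (f ^^ n) x) \<longlonglongrightarrow> p"
proof -
  have fp: "f p = p" using assms(1) by (auto simp: LAS_def fixed_point_def)
  have left: "(\<lambda>n. (f ^^ n) t) \<longlonglongrightarrow> p" if t: "c \<le> t" "t \<le> p" for t
  proof (rule orbit_tendsto_of_square)
    let ?g = "f \<circ> f"
    have g: "s \<le> ?g s \<and> ?g s \<le> p" if "c \<le> s" "s \<le> p" for s
    proof
      show "s \<le> ?g s"
        using above_diagonal_square[OF assms(1-4), of s] that fp by (cases "s = p") auto
      have "p \<le> f s" "f s \<le> 1"
        using decr_le[of s p] f_in_unit[of s] that fp c_pos assms(4) by auto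
      then show "?g s \<le> p" using decr_le[of p "f s"] fp assms(3) by auto
    qed
    have orb: "(?g ^^ n) t \<in> {c..p}" for n
      by (rule orbit_in_invariant) (use t g in force)+
    have mono: "monoseq (\<lambda>n. (?g ^^ n) t)"
      unfolding monoseq_Suc using g orb by simp
    have cont_g: "continuous_on {c..p} ?g"
    proof (intro continuous_on_compose continuous_on_subset[OF cont])
      show unit: "{c..p} \<subseteq> {0..1}" using c_pos assms(4) by simp
      then show "f ` {c..p} \<subseteq> {0..1}" using f_in_unit by blast
    qed
    obtain l where l: "l \<in> {c..p}" "?g l = l" "(\<lambda>n. (?g ^^ n) t) \<longlonglongrightarrow> l"
      by (rule monoseq_orbit_convergent[OF cont_g orb mono])
    then have "l = p" using above_diagonal_square[OF assms(1-4), of l] by (cases "l < p") auto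
    with l show *: "(\<lambda>n. (?g ^^ n) t) \<longlonglongrightarrow> p" by simp
    \<comment> \<open>The odd iterates are the images of the even ones under the continuous
      \<open>f\<close>, so they tend to \<open>f p = p\<close>.\<close>
    have "(\<lambda>n. f ((?g ^^ n) t)) \<longlonglongrightarrow> f p"
    proof (rule continuous_on_tendsto_compose[OF cont *])
      show "p \<in> {0..1}" using c_pos assms by auto
      show "\<forall>\<^sub>F n in sequentially. (?g ^^ n) t \<in> {0..1}"
      proof (rule always_eventually, rule allI)
        show "(?g ^^ n) t \<in> {0..1}" for n using orb[of n] c_pos assms(4) by auto
      qed
    qed
    moreover have "f ((?g ^^ n) t) = (?g ^^ n) (f t)" for n by (induction n) auto
    ultimately show "(\<lambda>n. (?g ^^ n) (f t)) \<longlonglongrightarrow> p" using fp by simp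
  qed
  \<comment> \<open>This makes \<open>f\<close> map the interval from \<open>p\<close> to
    \<open>f c\<close> into \<open>{c..p}\<close>, where \<open>left\<close> applies.\<close>
  have "c < f (f c)" using above_diagonal_square[OF assms(1-4), of c] assms(3) by simp
  have core: "(\<lambda>n. (f ^^ n) t) \<longlonglongrightarrow> p" if t: "c \<le> t" "t \<le> f c" for t
  proof (cases "t \<le> p")
    case False
    have "f (f c) \<le> f t" "f t \<le> p"
      using decr_le[of t "f c"] decr_le[of p t] False t fp f_c_le_1 assms(3) by auto
    then have "(\<lambda>n. (f ^^ n) (f t)) \<longlonglongrightarrow> p" using \<open>c < f (f c)\<close> by (intro left) auto
    then show ?thesis using orbit_tendsto_shift[of f 1 t p] by simp
  qed (use left t in auto)
  have above: "t < f t" if "0 < t" "t \<le> c" for t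
    using diagonal_signs(1)[OF assms(2) _ assms(4) fp, of t] c_pos that assms(3) by auto
  \<comment> \<open>Starting from \<open>f x\<close> makes the point reached on the right lap an
    image under \<open>f\<close>, hence at most \<open>f c\<close>, as \<open>core\<close>
    requires.\<close>
  have "0 < f x" "f x \<le> 1" using f_pos f_in_unit[of x] assms by auto
  then obtain n where n: "c \<le> (f ^^ n) (f x)"
    using orbit_reaches_right_lap[of "f x"] above by blast
  have "(f ^^ n) (f x) = f ((f ^^ n) x)" by (simp add: funpow_swap1)
  moreover have "(f ^^ n) x \<in> {0..1}"
    using assms f_in_unit by (intro orbit_in_invariant) auto
  ultimately have "(\<lambda>k. (f ^^ k) ((f ^^ n) (f x))) \<longlonglongrightarrow> p" using n f_le_f_c by (intro core) auto
  then show ?thesis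
    using orbit_tendsto_shift[of f "Suc n" x p] by (simp add: funpow_swap1)
qed

section \<open>Fixed points on the increasing lap, and the dichotomy for non-zero fixed
  points\<close>

lemma tendsto_fixed_point_left_lap:
  assumes "\<not> LAS f 0" "f p = p" "0 < p" "p \<le> c" "0 < x" "x < 1"
  shows "(\<lambda>n. (f ^^ n) x) \<longlonglongrightarrow> p"
proof -
  have "p < 1" using assms c_less_1 by simp
  note signs = diagonal_signs[OF assms(1,3) \<open>p < 1\<close> assms(2)]
  have left: "(\<lambda>n. (f ^^ n) t) \<longlonglongrightarrow> p" if t: "0 < t" "t \<le> c" for t
  proof -
    \<comment> \<open>Both sides of \<open>p\<close> are treated at once: \<open>f\<close> is
      increasing on \<open>{0..c}\<close>, so points between \<open>t\<close> and \<open>p\<close>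
      move towards \<open>p\<close> without passing it.\<close>
    define a b where "a = min t p" and "b = max t p"
    have ab: "0 < a" "b \<le> c" using t assms by (auto simp: a_def b_def)
    have inv: "(if t \<le> p then s \<le> f s else f s \<le> s) \<and> f s \<in> {a..b}" if "s \<in> {a..b}" for s
      using that signs[of s] incr_le[of s p] incr_le[of p s] t assms(2-4) c_less_1
      by (cases "s = p") (auto simp: a_def b_def split: if_splits)
    have orb: "(f ^^ n) t \<in> {a..b}" for n
      by (rule orbit_in_invariant) (use inv in \<open>auto simp: a_def b_def\<close>)
    have "monoseq (\<lambda>n. (f ^^ n) t)"
      unfolding monoseq_Suc using inv[OF orb] by (cases "t \<le> p") simp_all
    moreover have "continuous_on {a..b} f"
      using ab c_less_1 by (intro continuous_on_subset[OF cont]) auto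
    ultimately obtain l where l: "l \<in> {a..b}" "f l = l" "(\<lambda>n. (f ^^ n) t) \<longlonglongrightarrow> l"
      using monoseq_orbit_convergent orb by blast
    then have "l = p" using signs[of l] ab c_less_1 by force
    with l show ?thesis by simp
  qed
  show ?thesis
  proof (cases "x \<le> c")
    case False
    have "f c \<le> c" using signs(2)[of c] assms(2,4) c_less_1 by force
    then have "f x \<le> c" using f_le_f_c[of x] assms by force
    then have "(\<lambda>n. (f ^^ n) (f x)) \<longlonglongrightarrow> p" using f_pos assms by (intro left) auto
    then show ?thesis using orbit_tendsto_shift[of f 1 x p] by simp
  qed (use left assms in auto)
qed

text \<open>If 0 were LAS as well, orbits of small positive points would have the two limits 0 and
  \<open>p\<close>. The converse splits by the lap containing \<open>p\<close>.\<close>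

lemma GAS_nonzero_iff:
  assumes "p \<noteq> 0" "LAS f p"
  shows "GAS f p \<longleftrightarrow> \<not> LAS f 0"
proof
  assume gas: "GAS f p"
  show "\<not> LAS f 0"
  proof
    assume "LAS f 0"
    then obtain V where V: "unit_nbhd 0 V" "\<forall>x\<in>V. (\<lambda>n. (f ^^ n) x) \<longlonglongrightarrow> 0"
      by (auto simp: LAS_def attracting_def)
    obtain \<delta> where \<delta>: "0 < \<delta>" "\<And>x. x \<in> {0..1} \<Longrightarrow> \<bar>x - 0\<bar> < \<delta> \<Longrightarrow> x \<in> V"
      using unit_nbhdD[OF V(1)] by blast
    obtain x where "0 < x" "x < min \<delta> 1" using dense[of 0 "min \<delta> 1"] \<delta>(1) by auto
    then have "(\<lambda>n. (f ^^ n) x) \<longlonglongrightarrow> 0" "(\<lambda>n. (f ^^ n) x) \<longlonglongrightarrow> p"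
      using V(2) \<delta>(2)[of x] gas by (auto simp: GAS_def)
    then show False using LIMSEQ_unique assms(1) by blast
  qed
next
  assume "\<not> LAS f 0"
  have p: "p \<in> {0..1}" "f p = p" using assms(2) by (auto simp: LAS_def fixed_point_def)
  then have "0 < p" "p < 1" using assms(1) f_1 by (cases "p = 1"; auto)+
  then show "GAS f p"
    using tendsto_fixed_point_left_lap tendsto_fixed_point_right_lap assms(2) \<open>\<not> LAS f 0\<close> p(2)
    by (cases "p \<le> c") (auto simp: GAS_def)
qed

end

section \<open>The \<open>q\<close>-deformed logistic map\<close>

text \<open>Shows the deformation as an exponential between two affine maps, in the shape
  \<open>k * x + m\<close> (hence \<open>+ 0\<close>) that \<open>cross_ratio_affine\<close>
  matches.\<close>

lemma qdeform_exp:
  assumes "0 < q" "q \<noteq> 1"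
  shows "qdeform q x = (- 1 / (1 - q)) * exp (ln q * x + 0) + 1 / (1 - q)"
  using assms by (simp add: qdeform_def powr_def field_simps)

lemma qdeform_strict_mono:
  assumes "0 < q" "x < y"
  shows "qdeform q x < qdeform q y"
proof (cases q "1 :: real" rule: linorder_cases)
  case less
  then have "q powr y < q powr x" using assms by (intro powr_less_mono') auto
  then show ?thesis using less by (simp add: qdeform_def divide_strict_right_mono)
next
  case greater
  then have "q powr x < q powr y" using assms by (intro powr_less_mono) auto
  then show ?thesis using greater by (simp add: qdeform_def divide_strict_right_mono_neg)
qed (use assms in \<open>simp add: qdeform_def\<close>)

lemma cross_ratio_qdeform_le:
  assumes "0 < q" "a < b" "b < c" "c < d"
  shows "cross_ratio a b c d \<le> cross_ratio (qdeform q a) (qdeform q b) (qdeform q c) (qdeform q d)"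
proof (cases "q = 1")
  case False
  let ?l = "\<lambda>x. ln q * x + 0"
  have "ln q \<noteq> 0" using assms False by simp
  then have "cross_ratio a b c d = cross_ratio (?l a) (?l b) (?l c) (?l d)"
    by (rule cross_ratio_affine[symmetric])
  also have "\<dots> \<le> cross_ratio (exp (?l a)) (exp (?l b)) (exp (?l c)) (exp (?l d))"
  proof (cases "0 < ln q")
    case True
    then show ?thesis using assms by (intro cross_ratio_exp_le) auto
  next
    \<comment> \<open>For \<open>q < 1\<close> the factor \<open>ln q\<close> is negative and
      reverses the points, so both cross ratios are read backwards.\<close>
    case False
    then show ?thesis
      using assms \<open>ln q \<noteq> 0\<close>
      by (subst (1 2) cross_ratio_rev[symmetric], intro cross_ratio_exp_le) auto
  qed
  also have "\<dots> = cross_ratio (qdeform q a) (qdeform q b) (qdeform q c) (qdeform q d)"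
    unfolding qdeform_exp[OF assms(1) False] using False
    by (intro cross_ratio_affine[symmetric]) auto
  finally show ?thesis .
qed (simp add: qdeform_def)

lemma logistic_square: "logistic r x = (- r) * (x - 1/2)\<^sup>2 + r / 4"
  by (simp add: logistic_def power2_eq_square field_simps)

text \<open>The product form covers both laps: two positive factors on the left, two negative ones
  on the right.\<close>

lemma logistic_less:
  assumes "0 < r" "0 < (y - x) * (1 - x - y)"
  shows "logistic r x < logistic r y"
proof -
  have "logistic r y - logistic r x = r * ((y - x) * (1 - x - y))"
    by (simp add: logistic_def algebra_simps)
  then show ?thesis using mult_pos_pos[OF assms] by linarith
qed

lemma cross_ratio_logistic_less:
  assumes "0 < r" "w < x" "x < y" "y < z" "1/2 \<le> w \<or> z \<le> 1/2"
  shows "cross_ratio w x y z <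
    cross_ratio (logistic r w) (logistic r x) (logistic r y) (logistic r z)"
proof -
  have "cross_ratio w x y z = cross_ratio (w - 1/2) (x - 1/2) (y - 1/2) (z - 1/2)"
    by (simp add: cross_ratio_def)
  also have "\<dots> < cross_ratio ((w - 1/2)\<^sup>2) ((x - 1/2)\<^sup>2) ((y - 1/2)\<^sup>2) ((z - 1/2)\<^sup>2)"
    using assms by (intro cross_ratio_square_less) auto
  also have "\<dots> = cross_ratio (logistic r w) (logistic r x) (logistic r y) (logistic r z)"
    unfolding logistic_square using assms by (intro cross_ratio_affine[symmetric]) auto
  finally show ?thesis .
qed

lemma continuous_on_qlogistic:
  assumes "0 < q"
  shows "continuous_on A (qlogistic q r)"
proof (cases "q = 1")
  case True
  then show ?thesis
    by (auto simp: qlogistic_def qdeform_def logistic_def o_def intro!: continuous_intros)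
next
  case False
  then show ?thesis
    unfolding qlogistic_def o_def qdeform_exp[OF assms False] logistic_def
    by (intro continuous_intros) (use assms in auto)
qed

lemma cross_ratio_unimodal_qlogistic:
  assumes "0 < q" "0 < r" "r \<le> 4"
  shows "cross_ratio_unimodal (qlogistic q r) (1/2)"
proof
  show "continuous_on {0..1} (qlogistic q r)" using assms(1) by (rule continuous_on_qlogistic)
  show "qlogistic q r (1/2) \<le> 1" using qlogistic_in_unit[OF assms, of "1/2"] by simp
  show "qlogistic q r 0 = 0" "qlogistic q r 1 = 0"
    using assms(1) by (simp_all add: qlogistic_def qdeform_def logistic_def)
  show "qlogistic q r x < qlogistic q r y" if "0 \<le> x" "x < y" "y \<le> 1/2" for x y
    unfolding qlogistic_def o_def using that assms
    by (intro qdeform_strict_mono logistic_less mult_pos_pos) auto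
  show "qlogistic q r y < qlogistic q r x" if "1/2 \<le> x" "x < y" "y \<le> 1" for x y
    unfolding qlogistic_def o_def using that assms
    by (intro qdeform_strict_mono logistic_less mult_neg_neg) auto
  show "cross_ratio w x y z <
      cross_ratio (qlogistic q r w) (qlogistic q r x) (qlogistic q r y) (qlogistic q r z)"
    if "0 \<le> w" "w < x" "x < y" "y < z" "z \<le> 1/2" for w x y z
  proof -
    have "logistic r w < logistic r x" "logistic r x < logistic r y" "logistic r y < logistic r z"
      using that assms by (auto intro!: logistic_less mult_pos_pos)
    then show ?thesis
      using cross_ratio_logistic_less[of r w x y z] that assms(2)
        cross_ratio_qdeform_le[OF assms(1), of
          "logistic r w" "logistic r x" "logistic r y" "logistic r z"]
      by (simp add: qlogistic_def)
  qed
  show "cross_ratio w x y z <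
      cross_ratio (qlogistic q r w) (qlogistic q r x) (qlogistic q r y) (qlogistic q r z)"
    if "1/2 \<le> w" "w < x" "x < y" "y < z" "z \<le> 1" for w x y z
  proof -
    \<comment> \<open>The logistic map reverses the order here, so the deformation is applied to the
      points listed backwards.\<close>
    have "logistic r x < logistic r w" "logistic r y < logistic r x" "logistic r z < logistic r y"
      using that assms by (auto intro!: logistic_less mult_neg_neg)
    then show ?thesis
      using cross_ratio_logistic_less[of r w x y z] that assms(2)
        cross_ratio_qdeform_le[OF assms(1), of
          "logistic r z" "logistic r y" "logistic r x" "logistic r w"]
      by (simp add: qlogistic_def cross_ratio_rev)
  qed
qed auto

theorem theorem4p2:
  fixes q r :: real
  assumes "0 < q" and "0 < r" and "r \<le> 4"
  shows "(LAS (qlogistic q r) 0 \<longrightarrow>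
            (GAS (qlogistic q r) 0 \<longleftrightarrow> (\<forall>x\<in>{0<..<1}. qlogistic q r x < x))) \<and>
         (\<forall>p. p \<noteq> 0 \<and> LAS (qlogistic q r) p \<longrightarrow>
            (GAS (qlogistic q r) p \<longleftrightarrow> \<not> LAS (qlogistic q r) 0))"
proof -
  interpret cross_ratio_unimodal "qlogistic q r" "1/2"
    using assms by (rule cross_ratio_unimodal_qlogistic)
  show ?thesis using GAS_0_iff GAS_nonzero_iff by blast
qed

end
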